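(* Let $f\colon\mathbb{R}^n\to\mathbb{R}$ have a continuous gradient, be pseudoconvex, and have a global minimizer. Let $\{x_k\}_{k\ge 0}$ be a sequence generated by the regularized method (described in the context) with parameters $r\in[3,\infty)$, $\tau\in[0,\infty)$, $\eta>0$, $\sigma_{\max}\in[0,\infty)$ and symmetric matrices $\{Q_k\}$. Suppose that there are a real number $a>2\tau$ and a sequence $\{\psi_k\}\subseteq[0,\infty)$ with $\sum_{k=0}^\infty\psi_k<\infty$ such that, for all $k\ge 0$, $Q_k\succeq aI$ and $Q_{k+1}\preceq(1+\psi_k)Q_k$. Then $\{x_k\}$ is a variable metric quasi-Fejér monotone sequence with respect to $\mathcal{F}$ relative to $\{Q_k\}$, where $$\mathcal{F}:=\Bigl\{x\in\mathbb{R}^n\colon f(x)\le\lim_{k\to\infty}f(x_k)\Bigr\}.$$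
   Context: $\|\cdot\|$ is the Euclidean norm and, for matrices, the induced operator norm; for a symmetric positive definite matrix $Q$, $\|v\|_Q=(v^TQv)^{1/2}$. A continuously differentiable $f$ is pseudoconvex if, for all $x,y\in\mathbb{R}^n$, $\nabla f(x)^T(y-x)\ge 0$ implies $f(y)\ge f(x)$. For symmetric matrices, $A\preceq B$ (equivalently $B \succeq A$) means $B-A$ is positive semidefinite. Regularized method. Given $r\in[3,\infty)$, $\tau\in[0,\infty)$, $\eta>0$, $\sigma_{\max}\in[0,\infty)$ and a starting point $x_0\in\mathbb{R}^n$, at each iteration $k=0,1,\ldots$ one takes some $\sigma_k\in[0,\sigma_{\max}]$ and some symmetric matrix $Q_k\in\mathbb{R}^{n\times n}$, defines the model $$m_k(s)=f(x_k)+\nabla f(x_k)^Ts+\tfrac12 s^TQ_ks+\tfrac{\sigma_k}{r}\|s\|^r,$$ takes some $s_k\in\mathbb{R}^n$ with $\|\nabla m_k(s_k)\|\le\tau\|s_k\|\min\{\|s_k\|,1\}$, and sets either $x_{k+1}=x_k+s_k$ or $x_{k+1}=x_k$ in such a way that $$x_{k+1}\ne x_k\ \Rightarrow\ f(x_k)-f(x_{k+1})\ge\eta\,(m_k(0)-m_k(s_k))>0.$$ (Under the hypotheses of the claim, $\{f(x_k)\}$ is non-increasing and bounded below, so its limit exists.) Variable metric quasi-Fejér monotonicity. Let $\mathcal{F}\subseteq\mathbb{R}^n$ be non-empty and let $\{Q_k\}$ be symmetric $n\times n$ matrices for which there are $a>0$ and $b<\infty$ with $Q_k\succeq aI$ and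 $\|Q_k\|\le b$ for all $k\ge0$. A sequence $\{x_k\}\subseteq\mathbb{R}^n$ is variable metric quasi-Fejér monotone with respect to $\mathcal{F}$ relative to $\{Q_k\}$ if there are sequences $\{\tilde\psi_k\},\{\tilde\epsilon_k\}\subseteq[0,\infty)$ with $\sum_k\tilde\psi_k<\infty$ and $\sum_k\tilde\epsilon_k<\infty$ such that, for all $y\in\mathcal{F}$ and all $k\ge0$, $\|x_{k+1}-y\|_{Q_{k+1}}^2\le(1+\tilde\psi_k)\|x_k-y\|_{Q_k}^2+\tilde\epsilon_k$. (Being variable metric quasi-Fejér monotone includes the requirements that $\mathcal{F}$ be non-empty and that such $a,b$ exist.) *)

theory Defs
  imports "HOL-Analysis.Analysis"
begin

text \<open>Meaningful only where \<open>f\<close> is differentiable; it is only used at such points.\<close>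

definition gradient :: "('a::real_inner \<Rightarrow> real) \<Rightarrow> 'a \<Rightarrow> 'a" where
  "gradient f x = (THE D. GDERIV f x :> D)"

definition continuously_differentiable :: "('a::real_inner \<Rightarrow> real) \<Rightarrow> bool" where
  "continuously_differentiable f \<longleftrightarrow>
     (\<forall>x. f differentiable (at x)) \<and> continuous_on UNIV (gradient f)"

definition pseudoconvex :: "('a::real_inner \<Rightarrow> real) \<Rightarrow> bool" where
  "pseudoconvex f \<longleftrightarrow> continuously_differentiable f \<and>
     (\<forall>x y. gradient f x \<bullet> (y - x) \<ge> 0 \<longrightarrow> f y \<ge> f x)"

definition symmetric_mat :: "real^'n^'n \<Rightarrow> bool" where
  "symmetric_mat A \<longleftrightarrow> transpose A = A"

definition pos_semidef :: "real^'n^'n \<Rightarrow> bool" where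
  "pos_semidef A \<longleftrightarrow> symmetric_mat A \<and> (\<forall>v. v \<bullet> (A *v v) \<ge> 0)"

definition loewner_le :: "real^'n^'n \<Rightarrow> real^'n^'n \<Rightarrow> bool"  (infix "\<preceq>\<^sub>L" 50) where
  "A \<preceq>\<^sub>L B \<longleftrightarrow> pos_semidef (B - A)"

definition op_norm :: "real^'n^'n \<Rightarrow> real" where
  "op_norm A = onorm (\<lambda>v. A *v v)"

definition norm_wrt :: "real^'n^'n \<Rightarrow> real^'n \<Rightarrow> real" where
  "norm_wrt Q v = sqrt (v \<bullet> (Q *v v))"

definition reg_model ::
  "(real^'n \<Rightarrow> real) \<Rightarrow> real \<Rightarrow> real \<Rightarrow> real^'n^'n \<Rightarrow> real^'n \<Rightarrow> real^'n \<Rightarrow> real" where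
  "reg_model f r \<sigma> Q x s =
     f x + gradient f x \<bullet> s + (1/2) * (s \<bullet> (Q *v s)) + (\<sigma> / r) * norm s powr r"

text \<open>The starting point is \<open>x 0\<close>; \<open>\<sigma>\<close>, \<open>Q\<close> and \<open>s\<close> record the choices
  made in the successive iterations.\<close>

definition regularized_method ::
  "(real^'n \<Rightarrow> real) \<Rightarrow> real \<Rightarrow> real \<Rightarrow> real \<Rightarrow> real \<Rightarrow>
   (nat \<Rightarrow> real) \<Rightarrow> (nat \<Rightarrow> real^'n^'n) \<Rightarrow> (nat \<Rightarrow> real^'n) \<Rightarrow> (nat \<Rightarrow> real^'n) \<Rightarrow> bool" where
  "regularized_method f r \<tau> \<eta> \<sigma>max \<sigma> Q s x \<longleftrightarrow>
     (\<forall>k. let m = reg_model f r (\<sigma> k) (Q k) (x k) in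
        0 \<le> \<sigma> k \<and> \<sigma> k \<le> \<sigma>max \<and>
        symmetric_mat (Q k) \<and>
        norm (gradient m (s k)) \<le> \<tau> * norm (s k) * min (norm (s k)) 1 \<and>
        (x (Suc k) = x k + s k \<or> x (Suc k) = x k) \<and>
        (x (Suc k) \<noteq> x k \<longrightarrow>
           f (x k) - f (x (Suc k)) \<ge> \<eta> * (m 0 - m (s k)) \<and>
           \<eta> * (m 0 - m (s k)) > 0))"

definition variable_metric_quasi_Fejer ::
  "(real^'n) set \<Rightarrow> (nat \<Rightarrow> real^'n^'n) \<Rightarrow> (nat \<Rightarrow> real^'n) \<Rightarrow> bool" where
  "variable_metric_quasi_Fejer F Q x \<longleftrightarrow>
     F \<noteq> {} \<and>
     (\<forall>k. symmetric_mat (Q k)) \<and>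
     (\<exists>a b. a > 0 \<and> (\<forall>k. a *\<^sub>R mat 1 \<preceq>\<^sub>L Q k \<and> op_norm (Q k) \<le> b)) \<and>
     (\<exists>\<psi> \<epsilon>. (\<forall>k. \<psi> k \<ge> 0) \<and> (\<forall>k. \<epsilon> k \<ge> 0) \<and> summable \<psi> \<and> summable \<epsilon> \<and>
        (\<forall>y\<in>F. \<forall>k. (norm_wrt (Q (Suc k)) (x (Suc k) - y))\<^sup>2
                     \<le> (1 + \<psi> k) * (norm_wrt (Q k) (x k - y))\<^sup>2 + \<epsilon> k))"

end

theory Submission
  imports Defs
begin

text \<open>
  An accepted step \<open>s\<close> has \<open>Q s = e - g - \<sigma> \<parallel>s\<parallel>\<^sup>r\<^sup>-\<^sup>2 s\<close>, where \<open>g\<close> is the gradient of \<open>f\<close> and \<open>e\<close>,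
  the gradient of the model at \<open>s\<close>, is at most \<open>\<tau> \<parallel>s\<parallel>\<^sup>2\<close>. Inserting this into the model shows that
  the model, and hence \<open>f\<close>, decreases by at least a multiple of \<open>\<parallel>s\<parallel>\<^sup>2\<close>, so the squared step lengths
  are summable. For \<open>y\<close> in the level set, pseudoconvexity gives \<open>g \<bullet> (x - y) > 0\<close>. Inserting the same
  formula for \<open>Q s\<close> into the cross term of \<open>\<parallel>x + s - y\<parallel>\<^sub>Q\<^sup>2\<close> therefore leaves only errors of
  order \<open>\<parallel>s\<parallel>\<^sup>2 (1 + \<parallel>x - y\<parallel>)\<close>, which are summable relative to \<open>1 + \<parallel>x - y\<parallel>\<^sub>Q\<^sup>2\<close>.
\<close>

section \<open>Gradient of the regularized model\<close>

lemma gradient_eqI: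
  assumes "GDERIV f x :> D"
  shows "gradient f x = D"
proof -
  have "D' = D" if "GDERIV f x :> D'" for D'
  proof -
    have "(\<lambda>h. h \<bullet> D') = (\<lambda>h. h \<bullet> D)"
      using has_derivative_unique that assms unfolding gderiv_def by blast
    then have "(D' - D) \<bullet> D' = (D' - D) \<bullet> D" by meson
    then have "(D' - D) \<bullet> (D' - D) = 0" by (simp add: inner_diff_right)
    then show ?thesis by simp
  qed
  then show ?thesis
    unfolding gradient_def using assms by (rule the_equality[rotated])
qed

lemma inner_symmetric_mat_commute:
  assumes "symmetric_mat A"
  shows "u \<bullet> (A *v v) = v \<bullet> (A *v u)"
  using assms by (metis dot_lmul_matrix inner_commute symmetric_mat_def transpose_matrix_vector)

text \<open>The chain rule passes through \<open>norm\<close>, which has no gradient at the origin,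
  hence \<open>s \<noteq> 0\<close>; accepted steps satisfy this. The last summand is
  \<open>\<sigma> * norm s powr (r - 2)\<close> times \<open>s\<close>.\<close>

lemma GDERIV_reg_model:
  assumes "symmetric_mat Q" "s \<noteq> 0" "r \<noteq> 0"
  shows "GDERIV (reg_model f r \<sigma> Q x) s :>
    gradient f x + Q *v s + (\<sigma> * norm s powr (r - 1)) *\<^sub>R sgn s"
proof -
  have "GDERIV norm s :> sgn s" using assms(2) by (rule GDERIV_norm)
  moreover have "DERIV (\<lambda>t. t powr r) (norm s) :> r * norm s powr (r - 1)"
    using assms by (intro has_real_derivative_powr) simp
  ultimately have "GDERIV (\<lambda>s. norm s powr r) s :> (r * norm s powr (r - 1)) *\<^sub>R sgn s"
    by (rule GDERIV_DERIV_compose)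
  then have p: "((\<lambda>s. norm s powr r) has_derivative
      (\<lambda>h. h \<bullet> ((r * norm s powr (r - 1)) *\<^sub>R sgn s))) (at s)"
    by (simp add: gderiv_def)
  have l: "((\<lambda>s. Q *v s) has_derivative (\<lambda>h. Q *v h)) (at s)"
    by (rule bounded_linear_imp_has_derivative) simp
  show ?thesis
    unfolding gderiv_def reg_model_def
    by (rule derivative_eq_intros p l refl)+
      (use assms in \<open>simp add: fun_eq_iff algebra_simps inner_add_left inner_add_right
        inner_symmetric_mat_commute[of Q s] inner_commute\<close>)
qed

section \<open>Quadratic forms, the Loewner order and the operator norm\<close>

lemma loewner_le_quadratic_form:
  assumes "A \<preceq>\<^sub>L B"
  shows "v \<bullet> (A *v v) \<le> v \<bullet> (B *v v)"
  using assms
  by (simp add: loewner_le_def pos_semidef_def matrix_vector_mult_diff_rdistrib inner_diff_right)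

text \<open>Bounds pass from one metric to the next through quadratic forms; this turns them into
  the operator norm bound that quasi-Fejer monotonicity asks for.\<close>

lemma op_norm_le_quadratic_form:
  fixes A :: "real^'n^'n"
  assumes "pos_semidef A" "B > 0" "\<And>v. v \<bullet> (A *v v) \<le> B * (norm v)\<^sup>2"
  shows "op_norm A \<le> B"
  unfolding op_norm_def
proof (rule onorm_le)
  fix v :: "real^'n"
  define w where "w = A *v v"
  \<comment> \<open>testing nonnegativity at \<open>B v - A v\<close> replaces an eigenvalue argument\<close>
  have "0 \<le> (B *\<^sub>R v - w) \<bullet> (A *v (B *\<^sub>R v - w))"
    using assms by (simp add: pos_semidef_def)
  also have "\<dots> = B\<^sup>2 * (v \<bullet> (A *v v)) - 2 * B * (norm w)\<^sup>2 + w \<bullet> (A *v w)"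
    using assms(1) inner_symmetric_mat_commute[of A v w]
    by (simp add: pos_semidef_def matrix_vector_mult_diff_distrib matrix_vector_mult_scaleR
        inner_diff_left inner_diff_right dot_square_norm power2_eq_square[of B] algebra_simps
        flip: w_def)
  also have "\<dots> \<le> B\<^sup>2 * (B * (norm v)\<^sup>2) - 2 * B * (norm w)\<^sup>2 + B * (norm w)\<^sup>2"
    using assms by (intro add_mono diff_mono mult_left_mono) auto
  also have "\<dots> = B * ((B * norm v)\<^sup>2 - (norm w)\<^sup>2)"
    by (simp add: power2_eq_square algebra_simps)
  finally have "(norm w)\<^sup>2 \<le> (B * norm v)\<^sup>2"
    using assms by (simp add: zero_le_mult_iff)
  then show "norm (A *v v) \<le> B * norm v"
    using assms by (metis less_imp_le mult_nonneg_nonneg norm_ge_zero power2_le_imp_le w_def)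
qed

section \<open>Effect of a single step\<close>

text \<open>Pairing the model gradient with \<open>s\<close> shows that the linear term contributes
  minus the full quadratic form and \<open>\<sigma> * norm s powr r\<close>. The model adds back
  only 1/2 and 1/r of them, so the rest is gained; inexactness costs at most \<open>\<tau>\<close>
  times the squared step.\<close>

lemma reg_model_decrease:
  assumes grad: "norm (gradient f x + Q *v s + (\<sigma> * norm s powr (r - 1)) *\<^sub>R sgn s)
      \<le> \<tau> * norm s * min (norm s) 1"
    and "r \<ge> 1" "\<tau> \<ge> 0" "\<sigma> \<ge> 0" "a * (norm s)\<^sup>2 \<le> s \<bullet> (Q *v s)" "s \<noteq> 0"
  shows "(a / 2 - \<tau>) * (norm s)\<^sup>2 \<le> reg_model f r \<sigma> Q x 0 - reg_model f r \<sigma> Q x s"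
proof -
  define e where "e = gradient f x + Q *v s + (\<sigma> * norm s powr (r - 1)) *\<^sub>R sgn s"
  have "s \<bullet> sgn s = norm s"
    using assms by (simp add: sgn_div_norm inner_scaleR_right power2_norm_eq_inner[symmetric]
        power2_eq_square)
  moreover have "norm s powr (r - 1) * norm s = norm s powr r"
    using assms by (simp add: powr_diff)
  ultimately have "gradient f x \<bullet> s = e \<bullet> s - s \<bullet> (Q *v s) - \<sigma> * norm s powr r"
    by (simp add: e_def inner_add_left inner_commute[of _ s] inner_add_right mult.assoc)
  then have "reg_model f r \<sigma> Q x 0 - reg_model f r \<sigma> Q x s
      = - (e \<bullet> s) + (s \<bullet> (Q *v s)) / 2 + (\<sigma> - \<sigma> / r) * norm s powr r"
    using assms(2) by (simp add: reg_model_def algebra_simps)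
  moreover have "(\<sigma> - \<sigma> / r) * norm s powr r \<ge> 0"
    using assms(2,4) by (intro mult_nonneg_nonneg) (auto simp: divide_le_eq mult_le_cancel_left1)
  moreover have "e \<bullet> s \<le> \<tau> * (norm s)\<^sup>2"
  proof -
    have "e \<bullet> s \<le> norm e * norm s" by (rule norm_cauchy_schwarz)
    \<comment> \<open>The \<open>min\<close> is bounded by 1 here: a first-order error suffices
      because \<open>e\<close> is paired with \<open>s\<close>.\<close>
    also have "norm e \<le> \<tau> * norm s * 1"
      using grad mult_left_mono[of "min (norm s) 1" 1 "\<tau> * norm s"] assms(3)
      by (simp add: e_def)
    finally show ?thesis
      by (simp add: power2_eq_square mult_right_mono algebra_simps)
  qed
  ultimately show ?thesis using assms(5) by (simp add: algebra_simps)
qed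

lemma power2_norm_wrt:
  assumes "0 \<le> v \<bullet> (Q *v v)"
  shows "(norm_wrt Q v)\<^sup>2 = v \<bullet> (Q *v v)"
  using assms by (simp add: norm_wrt_def)

text \<open>In the application \<open>d\<close> is the iterate minus a point of the level set, and
  \<open>S\<close> bounds all steps, so that \<open>c\<close> does not depend on the
  iteration.\<close>

lemma quadratic_form_step:
  fixes Q :: "real^'n^'n"
  assumes sym: "symmetric_mat Q" and "a > 0"
    and grad: "norm (g + Q *v s + (\<sigma> * norm s powr (r - 1)) *\<^sub>R sgn s)
      \<le> \<tau> * norm s * min (norm s) 1"
    and g: "g \<bullet> d \<ge> 0" and "r \<ge> 3" "\<tau> \<ge> 0" "0 \<le> \<sigma>" "\<sigma> \<le> \<sigma>max"
    and s: "norm s \<le> S" "s \<bullet> (Q *v s) \<le> b * (norm s)\<^sup>2" "s \<noteq> 0"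
    and d: "a * (norm d)\<^sup>2 \<le> d \<bullet> (Q *v d)"
  defines "c \<equiv> \<tau> + \<sigma>max * S powr (r - 3)"
  shows "(d + s) \<bullet> (Q *v (d + s))
    \<le> (1 + c / a * (norm s)\<^sup>2) * (d \<bullet> (Q *v d)) + (c + b) * (norm s)\<^sup>2"
proof -
  define e where "e = g + Q *v s + (\<sigma> * norm s powr (r - 1)) *\<^sub>R sgn s"
  have Qs: "Q *v s = e - g - (\<sigma> * norm s powr (r - 1)) *\<^sub>R sgn s"
    by (simp add: e_def)
  \<comment> \<open>The \<open>min\<close> is now bounded by \<open>norm s\<close>: \<open>e\<close>
    gets paired with \<open>d\<close>, which supplies no further factor
    \<open>norm s\<close>.\<close>
  have "norm e \<le> \<tau> * norm s * norm s"
    using grad mult_left_mono[of "min (norm s) 1" "norm s" "\<tau> * norm s"] assms(6)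
    by (simp add: e_def)
  \<comment> \<open>As \<open>r \<ge> 3\<close>, splitting off the square leaves a nonnegative
    exponent, so \<open>S\<close> can replace \<open>norm s\<close> in the remaining power.\<close>
  moreover have "norm s powr (r - 1) = norm s powr (r - 3) * (norm s)\<^sup>2"
    using s powr_add[of "norm s" "r - 3" 2] by simp
  then have "\<sigma> * norm s powr (r - 1) \<le> \<sigma>max * (S powr (r - 3) * (norm s)\<^sup>2)"
    using assms by (auto intro!: mult_mono powr_mono2)
  ultimately have c: "norm e + \<sigma> * norm s powr (r - 1) \<le> c * (norm s)\<^sup>2"
    by (simp add: c_def power2_eq_square algebra_simps)
  have "d \<bullet> (Q *v s) = d \<bullet> e - g \<bullet> d - \<sigma> * norm s powr (r - 1) * (d \<bullet> sgn s)"
    by (simp add: Qs inner_diff_right inner_commute)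
  also have "\<dots> \<le> norm d * norm e + \<sigma> * norm s powr (r - 1) * norm d"
  proof -
    have "- (d \<bullet> sgn s) \<le> norm d"
      using norm_cauchy_schwarz[of "- d" "sgn s"] s by (simp add: norm_sgn)
    then have "\<sigma> * norm s powr (r - 1) * (- (d \<bullet> sgn s)) \<le> \<sigma> * norm s powr (r - 1) * norm d"
      using assms by (intro mult_left_mono) auto
    then show ?thesis using g norm_cauchy_schwarz[of d e] by linarith
  qed
  also have "\<dots> \<le> c * (norm s)\<^sup>2 * norm d"
    using mult_right_mono[OF c, of "norm d"] by (simp add: algebra_simps)
  finally have "2 * (d \<bullet> (Q *v s)) \<le> c * (norm s)\<^sup>2 * (2 * norm d)" by simp
  also have "\<dots> \<le> c * (norm s)\<^sup>2 * (1 + (d \<bullet> (Q *v d)) / a)"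
  proof (rule mult_left_mono)
    \<comment> \<open>Trades the term linear in \<open>norm d\<close> for a constant, which joins
      the additive error, and a square, which joins the factor of the quadratic form.\<close>
    have "2 * norm d \<le> 1 + (norm d)\<^sup>2"
      using sum_squares_bound[of 1 "norm d"] by simp
    moreover have "(norm d)\<^sup>2 \<le> (d \<bullet> (Q *v d)) / a"
      using d \<open>a > 0\<close> by (simp add: field_simps)
    ultimately show "2 * norm d \<le> 1 + (d \<bullet> (Q *v d)) / a" by linarith
    show "0 \<le> c * (norm s)\<^sup>2" using assms by (simp add: c_def)
  qed
  finally have "2 * (d \<bullet> (Q *v s)) \<le> c * (norm s)\<^sup>2 * (1 + (d \<bullet> (Q *v d)) / a)" .
  moreover have "(d + s) \<bullet> (Q *v (d + s)) = d \<bullet> (Q *v d) + 2 * (d \<bullet> (Q *v s)) + s \<bullet> (Q *v s)"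
    using inner_symmetric_mat_commute[OF sym, of s d]
    by (simp add: matrix_vector_right_distrib inner_add_left inner_add_right)
  ultimately show ?thesis using s(2) by (simp add: algebra_simps)
qed

section \<open>Uniform bounds and summability\<close>

text \<open>Iteration yields a product of factors \<open>1 + \<psi> i \<le> exp (\<psi> i)\<close>,
  which summability of \<open>\<psi>\<close> keeps bounded.\<close>

lemma loewner_quasi_decreasing_bounded:
  fixes Q :: "nat \<Rightarrow> real^'n^'n"
  assumes "\<And>k. \<psi> k \<ge> 0" "summable \<psi>" "pos_semidef (Q 0)"
    and "\<And>k. Q (Suc k) \<preceq>\<^sub>L (1 + \<psi> k) *\<^sub>R Q k"
  obtains b where "b > 0" "\<And>k v. v \<bullet> (Q k *v v) \<le> b * (norm v)\<^sup>2"
proof -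
  have q0: "v \<bullet> (Q 0 *v v) \<ge> 0" for v using assms by (simp add: pos_semidef_def)
  have q: "v \<bullet> (Q k *v v) \<le> exp (\<Sum>i<k. \<psi> i) * (v \<bullet> (Q 0 *v v))" for k v
  proof (induction k)
    case (Suc k)
    have "v \<bullet> (Q (Suc k) *v v) \<le> (1 + \<psi> k) * (v \<bullet> (Q k *v v))"
      using loewner_le_quadratic_form[OF assms(4), of v k]
      by (simp flip: scaleR_matrix_vector_assoc)
    also have "\<dots> \<le> (1 + \<psi> k) * (exp (\<Sum>i<k. \<psi> i) * (v \<bullet> (Q 0 *v v)))"
      using Suc assms(1) by (intro mult_left_mono) (auto simp: add_nonneg_nonneg)
    also have "\<dots> \<le> exp (\<psi> k) * (exp (\<Sum>i<k. \<psi> i) * (v \<bullet> (Q 0 *v v)))"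
      using q0 by (intro mult_right_mono) auto
    finally show ?case by (simp add: exp_add mult_ac)
  qed simp
  \<comment> \<open>The \<open>+ 1\<close> keeps \<open>b\<close> positive even if
    \<open>Q 0\<close> vanishes.\<close>
  define b where "b = exp (\<Sum>i. \<psi> i) * (op_norm (Q 0) + 1)"
  have n0: "op_norm (Q 0) \<ge> 0"
    by (simp add: op_norm_def onorm_pos_le)
  show ?thesis
  proof
    show "b > 0" using n0 by (simp add: b_def)
    fix k v
    have "v \<bullet> (Q 0 *v v) \<le> norm v * norm (Q 0 *v v)" by (rule norm_cauchy_schwarz)
    also have "\<dots> \<le> norm v * (op_norm (Q 0) * norm v)"
      unfolding op_norm_def by (intro mult_left_mono onorm) auto
    also have "\<dots> \<le> (op_norm (Q 0) + 1) * (norm v)\<^sup>2"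
      by (simp add: power2_eq_square algebra_simps)
    finally have "v \<bullet> (Q 0 *v v) \<le> (op_norm (Q 0) + 1) * (norm v)\<^sup>2" .
    moreover have "exp (\<Sum>i<k. \<psi> i) \<le> exp (\<Sum>i. \<psi> i)"
      using assms by (simp add: sum_le_suminf)
    ultimately have "exp (\<Sum>i<k. \<psi> i) * (v \<bullet> (Q 0 *v v))
        \<le> exp (\<Sum>i. \<psi> i) * ((op_norm (Q 0) + 1) * (norm v)\<^sup>2)"
      using q0 by (intro mult_mono) auto
    then show "v \<bullet> (Q k *v v) \<le> b * (norm v)\<^sup>2"
      using q[of v k] by (simp add: b_def mult_ac)
  qed
qed

lemma summable_if_le_decrement:
  fixes u \<delta> :: "nat \<Rightarrow> real"
  assumes "\<And>k. 0 \<le> \<delta> k" "C > 0" "\<And>k. C * \<delta> k \<le> u k - u (Suc k)" "\<And>k. m \<le> u k"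
  shows "summable \<delta>"
proof -
  have "summable (\<lambda>k. C * \<delta> k)"
  proof (rule summableI_nonneg_bounded)
    fix n
    have "(\<Sum>k<n. C * \<delta> k) \<le> (\<Sum>k<n. u k - u (Suc k))"
      using assms by (intro sum_mono) auto
    also have "\<dots> = u 0 - u n" by (rule sum_lessThan_telescope')
    also have "\<dots> \<le> u 0 - m" using assms by simp
    finally show "(\<Sum>k<n. C * \<delta> k) \<le> u 0 - m" .
  qed (use assms in auto)
  then show ?thesis using assms by (simp add: summable_cmult_iff)
qed

section \<open>Quasi-Fejer monotonicity of the iterates\<close>

theorem proposition1:
  fixes f :: "real^'n \<Rightarrow> real"
    and x s :: "nat \<Rightarrow> real^'n"
    and Q :: "nat \<Rightarrow> real^'n^'n"
    and \<sigma> \<psi> :: "nat \<Rightarrow> real"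
    and r \<tau> \<eta> \<sigma>max a :: real
  assumes "continuously_differentiable f"
    and "pseudoconvex f"
    and "\<exists>z. \<forall>y. f z \<le> f y"
    and "r \<ge> 3" and "\<tau> \<ge> 0" and "\<eta> > 0" and "\<sigma>max \<ge> 0"
    and "regularized_method f r \<tau> \<eta> \<sigma>max \<sigma> Q s x"
    and "a > 2 * \<tau>"
    and "\<And>k. \<psi> k \<ge> 0" and "summable \<psi>"
    and "\<And>k. a *\<^sub>R mat 1 \<preceq>\<^sub>L Q k"
    and "\<And>k. Q (Suc k) \<preceq>\<^sub>L (1 + \<psi> k) *\<^sub>R Q k"
  shows "variable_metric_quasi_Fejer {z. f z \<le> lim (\<lambda>k. f (x k))} Q x"
proof -
  define F where "F = {z. f z \<le> lim (\<lambda>k. f (x k))}"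
  \<comment> \<open>Actual displacements rather than \<open>s k\<close>: a rejected trial step
    leaves the iterate in place and is not controlled by the decrease of \<open>f\<close>.\<close>
  define \<delta> where "\<delta> k = (norm (x (Suc k) - x k))\<^sup>2" for k
  obtain z where z: "\<And>y. f z \<le> f y" using assms(3) by blast
  have a: "a > 0" using assms(5,9) by linarith
  have step: "0 \<le> \<sigma> k" "\<sigma> k \<le> \<sigma>max" "symmetric_mat (Q k)"
    "norm (gradient (reg_model f r (\<sigma> k) (Q k) (x k)) (s k)) \<le> \<tau> * norm (s k) * min (norm (s k)) 1"
    "x (Suc k) = x k + s k \<or> x (Suc k) = x k"
    "x (Suc k) \<noteq> x k \<Longrightarrow>
       f (x k) - f (x (Suc k)) \<ge> \<eta> * (reg_model f r (\<sigma> k) (Q k) (x k) 0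
         - reg_model f r (\<sigma> k) (Q k) (x k) (s k)) \<and>
       \<eta> * (reg_model f r (\<sigma> k) (Q k) (x k) 0 - reg_model f r (\<sigma> k) (Q k) (x k) (s k)) > 0"
    for k
    using assms(8) unfolding regularized_method_def Let_def by blast+
  have lower: "a * (norm v)\<^sup>2 \<le> v \<bullet> (Q k *v v)" for k v
    using loewner_le_quadratic_form[OF assms(12), of v k]
    by (simp add: power2_norm_eq_inner flip: scaleR_matrix_vector_assoc)
  have nonneg: "0 \<le> v \<bullet> (Q k *v v)" for k v
    using lower[of v k] a by (meson less_imp_le mult_nonneg_nonneg order_trans zero_le_power2)
  have psd: "pos_semidef (Q k)" for k
    using step(3) nonneg by (simp add: pos_semidef_def)
  obtain b where b: "b > 0" "\<And>k v. v \<bullet> (Q k *v v) \<le> b * (norm v)\<^sup>2"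
    using loewner_quasi_decreasing_bounded[OF assms(10,11) psd assms(13)] by metis
  have acc: "s k \<noteq> 0" "x (Suc k) = x k + s k"
    "norm (gradient f (x k) + Q k *v s k + (\<sigma> k * norm (s k) powr (r - 1)) *\<^sub>R sgn (s k))
      \<le> \<tau> * norm (s k) * min (norm (s k)) 1"
    if "x (Suc k) \<noteq> x k" for k
  proof -
    show s: "s k \<noteq> 0" and "x (Suc k) = x k + s k" using that step(5)[of k] by auto
    show "norm (gradient f (x k) + Q k *v s k + (\<sigma> k * norm (s k) powr (r - 1)) *\<^sub>R sgn (s k))
      \<le> \<tau> * norm (s k) * min (norm (s k)) 1"
      using step(4)[of k] gradient_eqI[OF GDERIV_reg_model[OF step(3)[of k] s, of r]] assms(4)
      by simp
  qed
  \<comment> \<open>The factor \<open>\<eta>\<close> comes from the acceptance test,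
    \<open>a / 2 - \<tau>\<close> from the model decrease; \<open>a > 2 * \<tau>\<close> makes the
    product positive.\<close>
  have decr: "\<eta> * (a / 2 - \<tau>) * \<delta> k \<le> f (x k) - f (x (Suc k))" for k
  proof (cases "x (Suc k) = x k")
    case True
    then show ?thesis by (simp add: \<delta>_def)
  next
    case False
    have "(a / 2 - \<tau>) * \<delta> k \<le> reg_model f r (\<sigma> k) (Q k) (x k) 0
        - reg_model f r (\<sigma> k) (Q k) (x k) (s k)"
      using reg_model_decrease[OF acc(3)[OF False] _ assms(5) step(1)[of k] lower acc(1)[OF False]]
        acc(2)[OF False] assms(4) by (simp add: \<delta>_def)
    then show ?thesis
      using step(6)[OF False] mult_left_mono[of _ _ \<eta>] assms(6)
      by (smt (verit) mult.assoc)
  qed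
  have \<eta>: "\<eta> * (a / 2 - \<tau>) > 0" using assms(6,9) by simp
  have \<delta>: "summable \<delta>" "\<And>k. \<delta> k \<ge> 0"
    using summable_if_le_decrement[of \<delta>, OF _ \<eta> decr, of "f z"] z by (auto simp: \<delta>_def)
  have "decseq (\<lambda>k. f (x k))"
    by (intro decseq_SucI)
      (metis decr \<delta>(2) \<eta> diff_ge_0_iff_ge less_imp_le mult_nonneg_nonneg order_trans)
  moreover from this obtain l where l: "(\<lambda>k. f (x k)) \<longlonglongrightarrow> l"
    by (rule decseq_convergent) (use z in auto)
  ultimately have lim: "lim (\<lambda>k. f (x k)) \<le> f (x k)" for k
    unfolding limI[OF l] by (rule decseq_ge)
  have "f z \<le> l"
    using l z by (intro LIMSEQ_le_const) auto
  then have z_lim: "z \<in> F"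
    by (simp add: F_def limI[OF l])
  obtain S where S: "norm (x (Suc k) - x k) \<le> S" for k
  proof -
    have "\<delta> k \<le> (\<Sum>k. \<delta> k)" for k
      using sum_le_suminf[OF \<delta>(1), of "{k}"] \<delta>(2) by simp
    then have "norm (x (Suc k) - x k) \<le> sqrt (\<Sum>k. \<delta> k)" for k
      by (intro real_le_rsqrt) (simp add: \<delta>_def)
    then show ?thesis by (rule that)
  qed
  define c where "c = \<tau> + \<sigma>max * S powr (r - 3)"
  have c: "c \<ge> 0" using assms by (simp add: c_def)
  have ineq: "(x (Suc k) - y) \<bullet> (Q k *v (x (Suc k) - y))
      \<le> (1 + c / a * \<delta> k) * ((x k - y) \<bullet> (Q k *v (x k - y))) + (c + b) * \<delta> k"
    if "y \<in> F" for y k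
  proof (cases "x (Suc k) = x k")
    case True
    then show ?thesis by (simp add: \<delta>_def)
  next
    case False
    \<comment> \<open>Pseudoconvexity is used in contrapositive form and so needs \<open>f y\<close>
      strictly below \<open>f (x k)\<close>. A real move decreases \<open>f\<close> strictly, and
      the limit is compared with the value at \<open>Suc k\<close>.\<close>
    have "\<delta> k > 0" using False by (simp add: \<delta>_def)
    then have "f (x (Suc k)) < f (x k)" using decr[of k] \<eta> by (smt (verit) mult_pos_pos)
    then have "f y < f (x k)" using that lim[of "Suc k"] by (simp add: F_def)
    then have "gradient f (x k) \<bullet> (x k - y) \<ge> 0"
      using assms(2) unfolding pseudoconvex_def
      by (smt (verit) inner_diff_right)
    from quadratic_form_step[OF step(3) a acc(3)[OF False] this assms(4,5) step(1,2) _ b(2)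
        acc(1)[OF False] lower, of S] S[of k] acc(2)[OF False]
    show ?thesis by (simp add: \<delta>_def c_def algebra_simps)
  qed
  \<comment> \<open>Chosen so that \<open>1 + \<psi>' k\<close> equals
    \<open>(1 + \<psi> k) * (1 + c / a * \<delta> k)\<close>: the factor for the change of metric
    times the factor for the step.\<close>
  define \<psi>' where "\<psi>' k = \<psi> k + (1 + \<psi> k) * (c / a * \<delta> k)" for k
  define \<epsilon> where "\<epsilon> k = (1 + \<psi> k) * ((c + b) * \<delta> k)" for k
  have "summable (\<lambda>k. (1 + \<psi> k) * \<delta> k)"
  proof -
    have "summable (\<lambda>k. \<psi> k * \<delta> k)"
    proof (rule summable_comparison_test'[OF summable_mult])
      show "summable \<delta>" by (rule \<delta>)
      fix k
      have "\<psi> k \<le> (\<Sum>k. \<psi> k)" using sum_le_suminf[OF assms(11), of "{k}"] assms(10) by simp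
      then show "norm (\<psi> k * \<delta> k) \<le> (\<Sum>k. \<psi> k) * \<delta> k"
        using \<delta>(2)[of k] assms(10)[of k] by (simp add: mult_right_mono)
    qed
    from summable_add[OF \<delta>(1) this] show ?thesis by (simp add: algebra_simps)
  qed
  from summable_mult[OF this] have "summable (\<lambda>k. (1 + \<psi> k) * (C * \<delta> k))" for C
    by (simp add: mult.left_commute)
  then have sums: "summable \<psi>'" "summable \<epsilon>"
    unfolding \<psi>'_def \<epsilon>_def by (auto intro: summable_add[OF assms(11)])
  have Fejer: "(norm_wrt (Q (Suc k)) (x (Suc k) - y))\<^sup>2
      \<le> (1 + \<psi>' k) * (norm_wrt (Q k) (x k - y))\<^sup>2 + \<epsilon> k" if "y \<in> F" for y k
  proof -
    \<comment> \<open>The metric is changed first, at the fixed new iterate; the step is then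
      estimated in the old metric \<open>Q k\<close>, to which the model refers.\<close>
    have "(x (Suc k) - y) \<bullet> (Q (Suc k) *v (x (Suc k) - y))
        \<le> (1 + \<psi> k) * ((x (Suc k) - y) \<bullet> (Q k *v (x (Suc k) - y)))"
      using loewner_le_quadratic_form[OF assms(13), of "x (Suc k) - y" k]
      by (simp flip: scaleR_matrix_vector_assoc)
    also have "\<dots> \<le> (1 + \<psi> k) * ((1 + c / a * \<delta> k) * ((x k - y) \<bullet> (Q k *v (x k - y)))
        + (c + b) * \<delta> k)"
      using ineq[OF that] assms(10)[of k] by (intro mult_left_mono) auto
    also have "\<dots> = (1 + \<psi>' k) * ((x k - y) \<bullet> (Q k *v (x k - y))) + \<epsilon> k"
      by (simp add: \<psi>'_def \<epsilon>_def algebra_simps)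
    finally show ?thesis by (simp add: power2_norm_wrt nonneg)
  qed
  have "\<psi>' k \<ge> 0 \<and> \<epsilon> k \<ge> 0" for k
    using assms(10)[of k] \<delta>(2)[of k] a b(1) c by (simp add: \<psi>'_def \<epsilon>_def)
  moreover have "op_norm (Q k) \<le> b" for k
    using op_norm_le_quadratic_form[OF psd b] .
  ultimately show ?thesis
    unfolding variable_metric_quasi_Fejer_def F_def[symmetric]
    using z_lim step(3) a assms(12) sums Fejer by blast
qed

end
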